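(* Let $\lambda$ be a nonzero real number and let $x,y\in\mathbb{R}$. For every integer $n\ge 0$, $$\beta_{n,\lambda}^{(c)}(1-x,y)=(-1)^{n}\beta_{n,-\lambda}^{(c)}(x,y)$$ and $$\beta_{n,\lambda}^{(s)}(1-x,y)=(-1)^{n+1}\beta_{n,-\lambda}^{(s)}(x,y).$$
   Context: All generating functions are power series in $t$ around $t=0$. For nonzero $\lambda\in\mathbb{R}$ and complex $z$, the degenerate exponential is $e_\lambda^{z}(t)=(1+\lambda t)^{z/\lambda}$, and $e_\lambda(t)=e_\lambda^1(t)$. The degenerate cosine and sine functions are $\cos_\lambda^{(y)}(t)=\frac{e_\lambda^{iy}(t)+e_\lambda^{-iy}(t)}{2}=\cos\left(\frac{y}{\lambda}\log(1+\lambda t)\right)$ and $\sin_\lambda^{(y)}(t)=\frac{e_\lambda^{iy}(t)-e_\lambda^{-iy}(t)}{2i}=\sin\left(\frac{y}{\lambda}\log(1+\lambda t)\right)$, with $i=\sqrt{-1}$. For any nonzero real $\lambda$ (positive or negative), the degenerate cosine-Bernoulli and sine-Bernoulli polynomials are defined by $\frac{t}{e_\lambda(t)-1}e_\lambda^{x}(t)\cos_\lambda^{(y)}(t)=\sum_{n=0}^{\infty}\beta_{n,\lambda}^{(c)}(x,y)\frac{t^n}{n!}$ and $\frac{t}{e_\lambda(t)-1}e_\lambda^{x}(t)\sin_\lambda^{(y)}(t)=\sum_{n=0}^{\infty}\beta_{n,\lambda}^{(s)}(x,y)\frac{t^n}{n!}$. *)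

theory Defs
  imports "HOL-Complex_Analysis.Complex_Analysis"
begin

text \<open>
  The generating functions are formal power series in \<open>t\<close> over \<open>\<complex>\<close>.  The series
  \<open>(1 + \<lambda> t)\<close> to the power \<open>z / \<lambda>\<close> is the library's binomial series with \<open>\<lambda> t\<close> substituted
  for its variable.  The parameter \<open>l\<close> is the \<open>\<lambda>\<close> of the mathematical text; the definitions
  are meaningful for \<open>l \<noteq> 0\<close> only.
\<close>

definition deg_exp :: "real \<Rightarrow> complex \<Rightarrow> complex fps" where
  "deg_exp l z = fps_compose (fps_binomial (z / of_real l)) (fps_const (of_real l) * fps_X)"

definition deg_cos :: "real \<Rightarrow> real \<Rightarrow> complex fps" where
  "deg_cos l y =
     fps_const (1 / 2) * (deg_exp l (\<i> * of_real y) + deg_exp l (- (\<i> * of_real y)))"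

definition deg_sin :: "real \<Rightarrow> real \<Rightarrow> complex fps" where
  "deg_sin l y =
     fps_const (1 / (2 * \<i>)) * (deg_exp l (\<i> * of_real y) - deg_exp l (- (\<i> * of_real y)))"

text \<open>
  The denominator \<open>deg_exp l 1 - 1\<close> has no constant term, but its linear coefficient is \<open>1\<close>, so
  the quotient below is a genuine power series quotient (see \<open>deg_bernoulli_gf_mult\<close>).
\<close>

definition deg_bernoulli_gf :: "real \<Rightarrow> complex fps" where
  "deg_bernoulli_gf l = fps_X / (deg_exp l 1 - 1)"

text \<open>The factor \<open>n!\<close> turns an ordinary coefficient into the coefficient of \<open>t\<^sup>n / n!\<close>.\<close>

definition cos_bernoulli :: "nat \<Rightarrow> real \<Rightarrow> real \<Rightarrow> real \<Rightarrow> complex" where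
  "cos_bernoulli n l x y =
     fact n * fps_nth (deg_bernoulli_gf l * deg_exp l (of_real x) * deg_cos l y) n"

definition sin_bernoulli :: "nat \<Rightarrow> real \<Rightarrow> real \<Rightarrow> real \<Rightarrow> complex" where
  "sin_bernoulli n l x y =
     fact n * fps_nth (deg_bernoulli_gf l * deg_exp l (of_real x) * deg_sin l y) n"

text \<open>The formal series are the expansions at \<open>t = 0\<close> of the functions they stand for.\<close>

lemma deg_exp_nth: "fps_nth (deg_exp l z) n = ((z / of_real l) gchoose n) * of_real l ^ n"
  by (simp add: deg_exp_def fps_compose_linear)

lemma deg_exp_has_fps_expansion:
  "(\<lambda>t. (1 + of_real l * t) powr (z / of_real l)) has_fps_expansion deg_exp l z"
proof -
  have "((\<lambda>u. (1 + u) powr (z / of_real l)) \<circ> (\<lambda>t. of_real l * t)) has_fps_expansion deg_exp l z"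
    unfolding deg_exp_def by (intro fps_expansion_intros) auto
  then show ?thesis
    by (simp add: o_def)
qed

lemma deg_cos_has_fps_expansion:
  "(\<lambda>t. cos (of_real y / of_real l * ln (1 + of_real l * t))) has_fps_expansion deg_cos l y"
proof -
  have *: "(\<lambda>t. (1 / 2) * ((1 + of_real l * t) powr (\<i> * of_real y / of_real l)
        + (1 + of_real l * t) powr (- (\<i> * of_real y) / of_real l))) has_fps_expansion deg_cos l y"
    unfolding deg_cos_def by (intro fps_expansion_intros deg_exp_has_fps_expansion)
  have nz: "eventually (\<lambda>t. 1 + of_real l * t \<noteq> 0) (nhds (0::complex))"
    by (rule eventually_nhds_in_open[THEN eventually_mono, of "{t. 1 + of_real l * t \<noteq> 0}"])
       (auto intro!: open_Collect_neq continuous_intros)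
  show ?thesis
    by (rule has_fps_expansion_cong[THEN iffD1, OF _ refl *], rule eventually_mono[OF nz])
       (simp add: powr_def cos_exp_eq mult_ac)
qed

lemma deg_sin_has_fps_expansion:
  "(\<lambda>t. sin (of_real y / of_real l * ln (1 + of_real l * t))) has_fps_expansion deg_sin l y"
proof -
  have *: "(\<lambda>t. (1 / (2 * \<i>)) * ((1 + of_real l * t) powr (\<i> * of_real y / of_real l)
        - (1 + of_real l * t) powr (- (\<i> * of_real y) / of_real l))) has_fps_expansion deg_sin l y"
    unfolding deg_sin_def by (intro fps_expansion_intros deg_exp_has_fps_expansion)
  have nz: "eventually (\<lambda>t. 1 + of_real l * t \<noteq> 0) (nhds (0::complex))"
    by (rule eventually_nhds_in_open[THEN eventually_mono, of "{t. 1 + of_real l * t \<noteq> 0}"])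
       (auto intro!: open_Collect_neq continuous_intros)
  show ?thesis
    by (rule has_fps_expansion_cong[THEN iffD1, OF _ refl *], rule eventually_mono[OF nz])
       (simp add: powr_def sin_exp_eq mult_ac)
qed

lemma deg_bernoulli_gf_mult:
  assumes "l \<noteq> 0"
  shows "deg_bernoulli_gf l * (deg_exp l 1 - 1) = fps_X"
proof -
  let ?d = "deg_exp l 1 - 1"
  have d: "fps_nth ?d 0 = 0" "fps_nth ?d 1 = 1"
    using assms by (simp_all add: deg_exp_nth)
  then have nz: "?d \<noteq> 0"
    by (metis fps_zero_nth zero_neq_one)
  have "subdegree ?d = 1"
    using d by (intro subdegreeI) auto
  then have "?d dvd fps_X"
    using nz by (simp add: fps_dvd_iff)
  then show ?thesis
    by (simp add: deg_bernoulli_gf_def)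
qed

end

theory Submission
  imports Defs
begin

text \<open>
  The substitution \<open>t \<mapsto> -t\<close> turns \<open>deg_exp (-l) z\<close> into \<open>deg_exp l (-z)\<close>.  Hence it maps the
  Bernoulli generating function for \<open>-l\<close> to \<open>-t / (deg_exp l (-1) - 1)\<close>, which equals
  \<open>t / (deg_exp l 1 - 1)\<close> times \<open>deg_exp l 1\<close>; the additional factor turns the argument \<open>-x\<close>
  into \<open>1 - x\<close>.  The cosine is even in \<open>y\<close> and the sine is odd.
\<close>

lemma deg_exp_0: "deg_exp l 0 = 1"
  by (simp add: deg_exp_def)

lemma deg_exp_add: "deg_exp l (a + b) = deg_exp l a * deg_exp l b"
  by (simp add: deg_exp_def add_divide_distrib fps_binomial_add_mult fps_compose_mult_distrib)

text \<open>Coefficientwise: the sign of \<open>- l\<close> in \<open>z / of_real (- l)\<close>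
  passes to \<open>z\<close>, while the one in \<open>(- l) ^ n\<close> cancels the
  \<open>(-1) ^ n\<close> coming from the substitution.\<close>

lemma deg_exp_reflect: "fps_compose (deg_exp (- l) z) (- fps_X) = deg_exp l (- z)"
proof (rule fps_ext)
  fix n
  have "(-1) ^ n * (- complex_of_real l) ^ n = of_real l ^ n"
    by (simp only: power_mult_distrib[symmetric]) simp
  then show "fps_nth (fps_compose (deg_exp (- l) z) (- fps_X)) n = fps_nth (deg_exp l (- z)) n"
    by (simp add: fps_compose_uminus' deg_exp_nth mult.left_commute)
qed

lemma deg_cos_reflect: "fps_compose (deg_cos (- l) y) (- fps_X) = deg_cos l y"
  by (simp add: deg_cos_def fps_compose_mult_distrib fps_compose_add_distrib deg_exp_reflect add.commute)

lemma deg_sin_reflect: "fps_compose (deg_sin (- l) y) (- fps_X) = - deg_sin l y"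
  by (simp add: deg_sin_def fps_compose_mult_distrib fps_compose_sub_distrib deg_exp_reflect algebra_simps)

lemma deg_bernoulli_gf_reflect:
  assumes "l \<noteq> 0"
  shows "fps_compose (deg_bernoulli_gf (- l)) (- fps_X) = deg_bernoulli_gf l * deg_exp l 1"
proof -
  let ?R = "fps_compose (deg_bernoulli_gf (- l)) (- fps_X)"
  let ?E = "deg_exp l 1"
  \<comment> \<open>Reflecting the product identity for \<open>- l\<close> avoids composing a
    quotient.\<close>
  have "?R * (deg_exp l (- 1) - 1)
      = fps_compose (deg_bernoulli_gf (- l) * (deg_exp (- l) 1 - 1)) (- fps_X)"
    by (simp add: fps_compose_mult_distrib fps_compose_sub_distrib deg_exp_reflect)
  also have "\<dots> = - fps_X"
    using assms by (simp add: deg_bernoulli_gf_mult)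
  finally have R: "?R * (deg_exp l (- 1) - 1) = - fps_X" .
  have inv: "deg_exp l (- 1) * ?E = 1"
    by (simp add: deg_exp_0 flip: deg_exp_add)
  \<comment> \<open>Multiplying \<open>deg_exp l (- 1) - 1\<close> by \<open>?E\<close> gives
    \<open>1 - ?E\<close>, so \<open>R\<close> becomes a relation with the denominator
    \<open>?E - 1\<close>.\<close>
  have "?R * (?E - 1) = - (?R * (deg_exp l (- 1) * ?E - ?E))"
    by (simp add: inv right_diff_distrib)
  also have "\<dots> = - (?R * (deg_exp l (- 1) - 1)) * ?E"
    by (simp add: algebra_simps)
  also have "\<dots> = deg_bernoulli_gf l * ?E * (?E - 1)"
    using deg_bernoulli_gf_mult[OF assms] by (simp add: R mult_ac)
  finally have "?R * (?E - 1) = deg_bernoulli_gf l * ?E * (?E - 1)" .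
  \<comment> \<open>Otherwise \<open>fps_X\<close> would be zero; this permits cancelling
    \<open>?E - 1\<close>.\<close>
  moreover have "?E - 1 \<noteq> 0"
    using deg_bernoulli_gf_mult[OF assms] by auto
  ultimately show ?thesis
    by simp
qed

lemma deg_bernoulli_gf_deg_exp_reflect:
  assumes "l \<noteq> 0"
  shows "fps_compose (deg_bernoulli_gf (- l) * deg_exp (- l) z) (- fps_X)
    = deg_bernoulli_gf l * deg_exp l (1 - z)"
  using deg_exp_add[of l 1 "- z"] assms
  by (simp add: fps_compose_mult_distrib deg_bernoulli_gf_reflect deg_exp_reflect mult.assoc)

theorem theorem3p2:
  fixes l x y :: real and n :: nat
  assumes "l \<noteq> 0"
  shows "cos_bernoulli n l (1 - x) y = (-1) ^ n * cos_bernoulli n (- l) x y \<and>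
         sin_bernoulli n l (1 - x) y = (-1) ^ (n + 1) * sin_bernoulli n (- l) x y"
proof
  let ?F = "\<lambda>l x. deg_bernoulli_gf l * deg_exp l (complex_of_real x)"
  have F: "fps_compose (?F (- l) x) (- fps_X) = ?F l (1 - x)"
    using deg_bernoulli_gf_deg_exp_reflect[OF assms, of "of_real x"] by simp
  have "fps_compose (?F (- l) x * deg_cos (- l) y) (- fps_X) = ?F l (1 - x) * deg_cos l y"
    \<comment> \<open>Only the outer product is split, so that \<open>F\<close> still
      matches.\<close>
    by (subst fps_compose_mult_distrib) (simp_all only: F deg_cos_reflect, simp)
  from arg_cong[OF this, of "\<lambda>f. fps_nth f n"]
  show "cos_bernoulli n l (1 - x) y = (-1) ^ n * cos_bernoulli n (- l) x y"
    by (simp add: cos_bernoulli_def fps_compose_uminus')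
  have "fps_compose (?F (- l) x * deg_sin (- l) y) (- fps_X) = - (?F l (1 - x) * deg_sin l y)"
    by (subst fps_compose_mult_distrib) (simp_all only: F deg_sin_reflect, simp_all)
  \<comment> \<open>The negation moves the sign from the odd sine to the other side, turning
    \<open>(-1) ^ n\<close> into \<open>(-1) ^ (n + 1)\<close>.\<close>
  from arg_cong[OF this, of "\<lambda>f. - fps_nth f n", symmetric]
  show "sin_bernoulli n l (1 - x) y = (-1) ^ (n + 1) * sin_bernoulli n (- l) x y"
    by (simp add: sin_bernoulli_def fps_compose_uminus' mult.left_commute)
qed

end
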